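(* Let $n\ge 2$ and $F=x_1x_2(y_1^2+y_2^2+\cdots+y_n^2)\in\mathbb{C}[x_1,x_2,y_1,\ldots,y_n]$. Then the Hilbert function of any minimal apolar set $\mathbb{X}$ of $F$ is $$\operatorname{HF}(\mathbb{X},0)=1,\quad \operatorname{HF}(\mathbb{X},1)=n+2,\quad \operatorname{HF}(\mathbb{X},2)=3n+1,\quad \operatorname{HF}(\mathbb{X},i)=4n\ \text{ for all } i\ge 3.$$
   Context: Let $T=\mathbb{C}[X_1,X_2,Y_1,\ldots,Y_n]$ act on $S=\mathbb{C}[x_1,x_2,y_1,\ldots,y_n]$ by differentiation ($X_i=\partial/\partial x_i$, $Y_j=\partial/\partial y_j$), written $g\circ F$, and let $F^\perp=\{g\in T:g\circ F=0\}$. $T$ is also the homogeneous coordinate ring of $\mathbb{P}^{n+1}$. For a finite set of points $\mathbb{X}\subset\mathbb{P}^{n+1}$, $I(\mathbb{X})\subset T$ is its homogeneous radical ideal and $\operatorname{HF}(\mathbb{X},i)=\dim_{\mathbb{C}}(T/I(\mathbb{X}))_i$. $\mathbb{X}$ is apolar to $F$ if $I(\mathbb{X})\subset F^\perp$, and is a minimal apolar set of $F$ if moreover $|\mathbb{X}|=\operatorname{Rk}F$, where the Waring rank $\operatorname{Rk}F$ is the least $r$ such that $F=\sum_{i=1}^r\alpha_iL_i^{\deg F}$ with $\alpha_i\in\mathbb{C}$ and $L_i$ linear forms (equivalently, the least cardinality of a finite set of points apolar to $F$). *)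

theory Defs
  imports Complex_Main "HOL-Library.Poly_Mapping"
begin

text \<open>
  Complex polynomials in variables indexed by \<open>nat\<close>, as finitely supported functions from
  exponent vectors to coefficients; the ring structure is the convolution ring of
  Poly_Mapping. The polynomial ring in \<open>N\<close> variables is the subring using only the variables
  with index \<open>< N\<close>; it models both \<open>S\<close> and \<open>T\<close>.
\<close>

type_synonym mono = "nat \<Rightarrow>\<^sub>0 nat"
type_synonym cpoly = "mono \<Rightarrow>\<^sub>0 complex"

definition const :: "complex \<Rightarrow> cpoly" where
  "const c = Poly_Mapping.single 0 c"

definition Var :: "nat \<Rightarrow> cpoly" where
  "Var i = Poly_Mapping.single (Poly_Mapping.single i 1) 1"

definition poly_ring :: "nat \<Rightarrow> cpoly set" where
  "poly_ring N = {p. \<forall>m\<in>Poly_Mapping.keys p. Poly_Mapping.keys m \<subseteq> {..<N}}"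

definition mono_degree :: "mono \<Rightarrow> nat" where
  "mono_degree m = (\<Sum>i\<in>Poly_Mapping.keys m. Poly_Mapping.lookup m i)"

definition total_degree :: "cpoly \<Rightarrow> nat" where
  "total_degree p = Max (insert 0 (mono_degree ` Poly_Mapping.keys p))"

definition forms :: "nat \<Rightarrow> nat \<Rightarrow> cpoly set" where
  "forms N d = {p \<in> poly_ring N. \<forall>m\<in>Poly_Mapping.keys p. mono_degree m = d}"

definition eval_at :: "(nat \<Rightarrow> complex) \<Rightarrow> cpoly \<Rightarrow> complex" where
  "eval_at v p = (\<Sum>m\<in>Poly_Mapping.keys p. Poly_Mapping.lookup p m *
     (\<Prod>i\<in>Poly_Mapping.keys m. v i ^ Poly_Mapping.lookup m i))"

text \<open>Exponent subtraction truncates, but only in terms whose coefficient is multiplied by 0.\<close>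

definition partial_deriv :: "nat \<Rightarrow> cpoly \<Rightarrow> cpoly" where
  "partial_deriv i p = (\<Sum>m\<in>Poly_Mapping.keys p.
     Poly_Mapping.single (m - Poly_Mapping.single i 1)
       (of_nat (Poly_Mapping.lookup m i) * Poly_Mapping.lookup p m))"

definition mono_deriv :: "mono \<Rightarrow> cpoly \<Rightarrow> cpoly" where
  "mono_deriv a =
     foldr (\<lambda>i. partial_deriv i ^^ Poly_Mapping.lookup a i)
       (sorted_list_of_set (Poly_Mapping.keys a))"

text \<open>The action of \<open>g\<close> as a constant-coefficient differential operator on \<open>F\<close>.\<close>

definition diff_act :: "cpoly \<Rightarrow> cpoly \<Rightarrow> cpoly" (infixr "\<circ>\<^sub>D" 75) where
  "g \<circ>\<^sub>D F = (\<Sum>a\<in>Poly_Mapping.keys g. const (Poly_Mapping.lookup g a) * mono_deriv a F)"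

definition perp :: "nat \<Rightarrow> cpoly \<Rightarrow> cpoly set" where
  "perp N F = {g \<in> poly_ring N. g \<circ>\<^sub>D F = 0}"

text \<open>
  Points of the projective space of \<open>\<complex>\<^sup>N\<close> are the classes of nonzero vectors of \<open>\<complex>\<^sup>N\<close> (functions
  vanishing from \<open>N\<close> on) modulo nonzero scalars, so cardinalities of sets of points count
  distinct projective points.
\<close>

definition proj_point :: "(nat \<Rightarrow> complex) \<Rightarrow> (nat \<Rightarrow> complex) set" where
  "proj_point v = {\<lambda>i. c * v i | c. c \<noteq> 0}"

definition proj_space :: "nat \<Rightarrow> (nat \<Rightarrow> complex) set set" where
  "proj_space N = {proj_point v | v. (\<forall>i\<ge>N. v i = 0) \<and> (\<exists>i. v i \<noteq> 0)}"

text \<open>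
  Vanishing is required at all homogeneous coordinates of each point, which makes this the
  homogeneous radical ideal of \<open>X\<close> (not just the polynomials vanishing at some representatives).
\<close>

definition vanishing_ideal :: "nat \<Rightarrow> (nat \<Rightarrow> complex) set set \<Rightarrow> cpoly set" where
  "vanishing_ideal N X = {g \<in> poly_ring N. \<forall>P\<in>X. \<forall>v\<in>P. eval_at v g = 0}"

text \<open>
  Dimension of the quotient of complex vector spaces \<open>V / W\<close>: the number \<open>k\<close> of elements of a
  basis, given by representatives \<open>b 0, \<dots>, b (k - 1)\<close> in \<open>V\<close>; every class is a linear combination
  of theirs with unique coefficients.
\<close>

definition quot_dim :: "cpoly set \<Rightarrow> cpoly set \<Rightarrow> nat" where
  "quot_dim V W = (THE k. \<exists>b. (\<forall>j<k. b j \<in> V) \<and>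
     (\<forall>v\<in>V. \<exists>!c. (\<forall>j\<ge>k. c j = 0) \<and> v - (\<Sum>j<k. const (c j) * b j) \<in> W))"

definition hilbert_fun :: "nat \<Rightarrow> (nat \<Rightarrow> complex) set set \<Rightarrow> nat \<Rightarrow> nat" where
  "hilbert_fun N X i = quot_dim (forms N i) (vanishing_ideal N X \<inter> forms N i)"

definition waring_rank :: "nat \<Rightarrow> cpoly \<Rightarrow> nat" where
  "waring_rank N F = (LEAST r. \<exists>\<alpha> L. (\<forall>i<r. L i \<in> forms N 1) \<and>
     F = (\<Sum>i<r. const (\<alpha> i) * L i ^ total_degree F))"

definition apolar_set :: "nat \<Rightarrow> cpoly \<Rightarrow> (nat \<Rightarrow> complex) set set \<Rightarrow> bool" where
  "apolar_set N F X \<longleftrightarrow>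
     finite X \<and> X \<subseteq> proj_space N \<and> vanishing_ideal N X \<subseteq> perp N F"

definition minimal_apolar_set :: "nat \<Rightarrow> cpoly \<Rightarrow> (nat \<Rightarrow> complex) set set \<Rightarrow> bool" where
  "minimal_apolar_set N F X \<longleftrightarrow> apolar_set N F X \<and> card X = waring_rank N F"

text \<open>Variables: \<open>x\<^sub>1 = Var 0\<close>, \<open>x\<^sub>2 = Var 1\<close> and \<open>y\<^sub>j = Var (j + 1)\<close> for \<open>1 \<le> j \<le> n\<close>.\<close>

definition F_quadric :: "nat \<Rightarrow> cpoly" where
  "F_quadric n = Var 0 * Var 1 * (\<Sum>j=1..n. Var (j + 1) ^ 2)"

end

theory Submission
  imports Defs "HOL-Computational_Algebra.Polynomial"
begin

text \<open>
  Write \<open>Y\<^sub>0, \<dots>, Y\<^sub>n\<^sub>-\<^sub>1\<close> for the variables dual to the \<open>y\<close>-variables. A minimal apolar set \<open>X\<close> has at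
  most \<open>4 n\<close> points, because the quartic is a sum of \<open>4 n\<close> fourth powers
  (\<open>waring_rank_F_quadric_le\<close>). The Hilbert function is found by exhibiting a basis of
  \<open>T\<^sub>i / I(X)\<^sub>i\<close> for every \<open>i\<close>.

  Let \<open>t = \<Sum> s\<^sup>k Y\<^sub>k\<close> be a linear form that vanishes at none of the points of \<open>X\<close> that have a nonzero
  \<open>y\<close>-coordinate (\<open>y_form_avoiding_points\<close>). The \<open>4 n\<close> products of \<open>1, X\<^sub>1, X\<^sub>2, X\<^sub>1 X\<^sub>2\<close> with
  \<open>1, Y\<^sub>1, \<dots>, Y\<^sub>n\<^sub>-\<^sub>1\<close> have degrees \<open>0\<close> to \<open>3\<close>, and those of degree at most \<open>i\<close> number \<open>1\<close>, \<open>n + 2\<close>,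
  \<open>3 n + 1\<close>, \<open>4 n\<close> for \<open>i = 0, 1, 2\<close> and \<open>i \<ge> 3\<close>. Multiplied by powers of \<open>t\<close> into degree \<open>i\<close>, they are
  the basis.

  Apolarity enters through the functional that maps \<open>g\<close> to the sum of its coefficients at the
  monomials \<open>X\<^sub>1 X\<^sub>2 Y\<^sub>j\<^sup>2\<close>. It is half the constant coefficient of \<open>g \<circ> F\<close>, so it vanishes on \<open>I(X)\<close>, and
  it maps \<open>Y\<^sub>i Y\<^sub>j r\<close> to the coefficient of \<open>X\<^sub>1 X\<^sub>2\<close> in \<open>r\<close> if \<open>i = j\<close> and to \<open>0\<close> otherwise. Hence it
  vanishes on all multiples of \<open>(Y\<^sub>k - s\<^sup>k Y\<^sub>0) t\<close>, and multiples of \<open>Y\<^sub>k - s\<^sup>k Y\<^sub>0\<close> serve as test forms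
  that separate monomials of the same degree while ignoring everything divisible by \<open>t\<close>
  (\<open>F_pairing_dual_form_y_form\<close>, \<open>F_pairing_dual_form_basis_form\<close>). Moreover, test forms vanish at the
  points whose \<open>y\<close>-coordinates are all zero, so they may be applied to forms that vanish only at the
  other points of \<open>X\<close>. In a relation between the lifted monomials the coefficients in the top degree
  therefore vanish, the rest is divisible by \<open>t\<close>, and induction on the degree proves independence on
  the points with a nonzero \<open>y\<close>-coordinate (\<open>lifted_forms_independent\<close>).

  In degree \<open>3\<close> this yields \<open>4 n\<close> independent functions on these points. So there are exactly \<open>4 n\<close> of
  them, they are all of \<open>X\<close>, and \<open>t\<close> has no zero on \<open>X\<close>. In degrees \<open>i \<ge> 3\<close> the independent family is
  as large as \<open>X\<close> and hence spans. From degree \<open>i + 1\<close> the spanning property descends to degree \<open>i\<close>: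
  expand \<open>t g\<close>, observe with the same test forms that no monomial of degree \<open>i + 1\<close> occurs, and
  divide by \<open>t\<close> (\<open>lifted_forms_span_down\<close>).
\<close>

section \<open>Coefficients of products\<close>

lemma lookup_single_mult_add:
  "Poly_Mapping.lookup (Poly_Mapping.single a c * q) (a + m) = c * Poly_Mapping.lookup q m"
  for q :: cpoly
  by (simp add: lookup_mult lookup_single when_mult)

lemma lookup_single_mult_not_multiple:
  fixes q :: cpoly
  assumes "\<And>m. k \<noteq> a + m"
  shows "Poly_Mapping.lookup (Poly_Mapping.single a c * q) k = 0"
  using assms by (simp add: lookup_mult lookup_single when_mult)

lemma lookup_const_mult [simp]:
  "Poly_Mapping.lookup (const c * q) m = c * Poly_Mapping.lookup q m"
  using lookup_single_mult_add[of 0 c q m] by (simp add: const_def)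

lemma lookup_Var_mult:
  "Poly_Mapping.lookup (Var i * q) k =
     (if Poly_Mapping.lookup k i = 0 then 0
      else Poly_Mapping.lookup q (k - Poly_Mapping.single i 1))"
proof (cases "Poly_Mapping.lookup k i = 0")
  case True
  then have "k \<noteq> Poly_Mapping.single i 1 + m" for m
    by (auto simp: lookup_add)
  then show ?thesis
    using True by (simp add: Var_def lookup_single_mult_not_multiple)
next
  case False
  then have "k = Poly_Mapping.single i 1 + (k - Poly_Mapping.single i 1)"
    by (intro poly_mapping_eqI) (auto simp: lookup_add lookup_minus lookup_single when_def)
  then show ?thesis
    using False lookup_single_mult_add[of "Poly_Mapping.single i 1" 1 q "k - Poly_Mapping.single i 1"]
    by (simp add: Var_def)
qed

lemma const_simps [simp]:
  "const 0 = 0" "const 1 = 1" "const (numeral w) = numeral w"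
  by (simp_all add: const_def)

lemma const_mult: "const (a * b) = const a * const b"
  by (simp add: const_def mult_single)

lemma const_add: "const (a + b) = const a + const b"
  by (simp add: const_def single_add)

lemma const_diff: "const (a - b) = const a - const b"
  by (simp add: const_def single_diff)

lemma const_uminus: "const (- a) = - const a"
  by (simp add: const_def single_uminus)

lemma const_power: "const (a ^ k) = const a ^ k"
  by (induction k) (simp_all add: const_mult)

lemma const_sum: "const (sum f A) = (\<Sum>x\<in>A. const (f x))"
  by (induction A rule: infinite_finite_induct) (simp_all add: const_add)

lemma sum_of_monomials:
  fixes p :: "'a \<Rightarrow>\<^sub>0 'b :: comm_monoid_add"
  shows "p = (\<Sum>m\<in>Poly_Mapping.keys p. Poly_Mapping.single m (Poly_Mapping.lookup p m))"
  by (rule poly_mapping_eqI)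
     (auto simp: lookup_sum lookup_single when_def in_keys_iff)

section \<open>Forms\<close>

lemma mono_degree_superset:
  assumes "finite A" "Poly_Mapping.keys m \<subseteq> A"
  shows "mono_degree m = (\<Sum>i\<in>A. Poly_Mapping.lookup m i)"
  unfolding mono_degree_def using assms
  by (intro sum.mono_neutral_left) (auto simp: in_keys_iff)

lemma mono_degree_add: "mono_degree (a + b) = mono_degree a + mono_degree b"
proof -
  let ?A = "Poly_Mapping.keys a \<union> Poly_Mapping.keys b"
  have "mono_degree c = (\<Sum>i\<in>?A. Poly_Mapping.lookup c i)" if "c \<in> {a, b, a + b}" for c
    using that keys_add[of a b] by (intro mono_degree_superset) auto
  then show ?thesis
    by (simp add: lookup_add sum.distrib)
qed

lemma mono_degree_single [simp]: "mono_degree (Poly_Mapping.single i k) = k"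
  by (simp add: mono_degree_def)

lemma mono_degree_0 [simp]: "mono_degree 0 = 0"
  by (simp add: mono_degree_def)

lemma forms_iff:
  "p \<in> forms N d \<longleftrightarrow>
     (\<forall>m\<in>Poly_Mapping.keys p. Poly_Mapping.keys m \<subseteq> {..<N} \<and> mono_degree m = d)"
  by (auto simp: forms_def poly_ring_def)

lemma forms_zero [simp]: "0 \<in> forms N d"
  by (simp add: forms_iff)

lemma forms_add: "p \<in> forms N d \<Longrightarrow> q \<in> forms N d \<Longrightarrow> p + q \<in> forms N d"
  using keys_add[of p q] by (auto simp: forms_iff)

lemma forms_mult:
  assumes "p \<in> forms N d" "q \<in> forms N e"
  shows "p * q \<in> forms N (d + e)"
  unfolding forms_iff
proof
  fix m assume "m \<in> Poly_Mapping.keys (p * q)"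
  then obtain a b where ab: "m = a + b" "a \<in> Poly_Mapping.keys p" "b \<in> Poly_Mapping.keys q"
    using keys_mult[of p q] by auto
  then show "Poly_Mapping.keys m \<subseteq> {..<N} \<and> mono_degree m = d + e"
    using assms keys_add[of a b] by (fastforce simp: forms_iff mono_degree_add)
qed

lemma forms_const [simp]: "const c \<in> forms N 0"
  by (auto simp: forms_iff const_def split: if_splits)

lemma forms_one [simp]: "1 \<in> forms N 0"
  using forms_const[of 1 N] by simp

lemma forms_const_mult: "p \<in> forms N d \<Longrightarrow> const c * p \<in> forms N d"
  using forms_mult[OF forms_const, of p N d c] by simp

lemma forms_diff: "p \<in> forms N d \<Longrightarrow> q \<in> forms N d \<Longrightarrow> p - q \<in> forms N d"
  using forms_add[of p N d "const (- 1) * q"] forms_const_mult[of q N d "- 1"]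
  by (simp add: const_uminus)

lemma forms_sum: "(\<And>x. x \<in> A \<Longrightarrow> f x \<in> forms N d) \<Longrightarrow> sum f A \<in> forms N d"
  by (induction A rule: infinite_finite_induct) (simp_all add: forms_add)

lemma forms_Var: "i < N \<Longrightarrow> Var i \<in> forms N 1"
  by (simp add: forms_iff Var_def)

lemmas forms_Var_Suc [simp] = forms_Var[unfolded One_nat_def]

lemma forms_power: "p \<in> forms N d \<Longrightarrow> p ^ k \<in> forms N (k * d)"
  by (induction k) (simp_all add: forms_mult)

lemma total_degree_form:
  assumes "p \<in> forms N d" "p \<noteq> 0"
  shows "total_degree p = d"
proof -
  obtain m where "m \<in> Poly_Mapping.keys p"
    using assms(2) sum_of_monomials[of p] by force
  then have "mono_degree ` Poly_Mapping.keys p = {d}"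
    using assms(1) by (auto simp: forms_iff)
  then show ?thesis
    by (simp add: total_degree_def)
qed

section \<open>Evaluation\<close>

definition mono_eval :: "(nat \<Rightarrow> complex) \<Rightarrow> mono \<Rightarrow> complex" where
  "mono_eval v m = (\<Prod>i\<in>Poly_Mapping.keys m. v i ^ Poly_Mapping.lookup m i)"

lemma mono_eval_superset:
  assumes "finite A" "Poly_Mapping.keys m \<subseteq> A"
  shows "mono_eval v m = (\<Prod>i\<in>A. v i ^ Poly_Mapping.lookup m i)"
  unfolding mono_eval_def using assms
  by (intro prod.mono_neutral_left) (auto simp: in_keys_iff)

lemma mono_eval_add: "mono_eval v (a + b) = mono_eval v a * mono_eval v b"
proof -
  let ?A = "Poly_Mapping.keys a \<union> Poly_Mapping.keys b"
  have "mono_eval v c = (\<Prod>i\<in>?A. v i ^ Poly_Mapping.lookup c i)" if "c \<in> {a, b, a + b}" for c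
    using that keys_add[of a b] by (intro mono_eval_superset) auto
  then show ?thesis
    by (simp add: lookup_add power_add prod.distrib)
qed

lemma eval_at_superset:
  assumes "finite A" "Poly_Mapping.keys p \<subseteq> A"
  shows "eval_at v p = (\<Sum>m\<in>A. Poly_Mapping.lookup p m * mono_eval v m)"
  unfolding eval_at_def mono_eval_def[symmetric] using assms
  by (intro sum.mono_neutral_left) (auto simp: in_keys_iff)

lemma eval_at_add [simp]: "eval_at v (p + q) = eval_at v p + eval_at v q"
proof -
  let ?A = "Poly_Mapping.keys p \<union> Poly_Mapping.keys q"
  have "eval_at v c = (\<Sum>m\<in>?A. Poly_Mapping.lookup c m * mono_eval v m)" if "c \<in> {p, q, p + q}" for c
    using that keys_add[of p q] by (intro eval_at_superset) auto
  then show ?thesis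
    by (simp add: lookup_add distrib_right sum.distrib)
qed

lemma eval_at_single [simp]: "eval_at v (Poly_Mapping.single m c) = c * mono_eval v m"
  by (subst eval_at_superset[of "{m}"]) auto

lemma eval_at_zero [simp]: "eval_at v 0 = 0"
  by (simp add: eval_at_def)

lemma eval_at_sum: "eval_at v (sum f A) = (\<Sum>x\<in>A. eval_at v (f x))"
  by (induction A rule: infinite_finite_induct) simp_all

lemma eval_at_mult [simp]: "eval_at v (p * q) = eval_at v p * eval_at v q"
proof -
  have "p * q = (\<Sum>a\<in>Poly_Mapping.keys p. \<Sum>b\<in>Poly_Mapping.keys q.
      Poly_Mapping.single a (Poly_Mapping.lookup p a) * Poly_Mapping.single b (Poly_Mapping.lookup q b))"
    by (subst sum_of_monomials[of p], subst sum_of_monomials[of q]) (rule sum_product)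
  then show ?thesis
    by (simp add: eval_at_sum mult_single mono_eval_add)
       (simp add: eval_at_def mono_eval_def[symmetric] sum_product mult_ac)
qed

lemma eval_at_const [simp]: "eval_at v (const c) = c"
  by (simp add: const_def mono_eval_def)

lemma eval_at_diff [simp]: "eval_at v (p - q) = eval_at v p - eval_at v q"
  using eval_at_add[of v "p - q" q] by simp

lemma eval_at_Var [simp]: "eval_at v (Var i) = v i"
  by (simp add: Var_def mono_eval_def)

lemma eval_at_scaled_form:
  assumes "p \<in> forms N d"
  shows "eval_at (\<lambda>i. c * v i) p = c ^ d * eval_at v p"
proof -
  have "mono_eval (\<lambda>i. c * v i) m = c ^ mono_degree m * mono_eval v m" for m
    by (simp add: mono_eval_def mono_degree_def power_mult_distrib prod.distrib power_sum)
  then show ?thesis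
    using assms by (simp add: eval_at_def mono_eval_def[symmetric] forms_iff sum_distrib_left mult_ac)
qed

text \<open>
  Because a form changes only by a nonzero factor along the representatives of a point, one
  representative per point decides whether it vanishes on a set of points.
\<close>

definition coords :: "(nat \<Rightarrow> complex) set \<Rightarrow> nat \<Rightarrow> complex" where
  "coords P = (SOME v. v \<in> P)"

lemma coords_mem:
  assumes "P \<in> proj_space N"
  shows "coords P \<in> P" "P = proj_point (coords P)"
proof -
  obtain v where P: "P = proj_point v"
    using assms by (auto simp: proj_space_def)
  have "v \<in> P"
    using P by (auto simp: proj_point_def intro: exI[of _ 1])
  then show mem: "coords P \<in> P"
    unfolding coords_def by (rule someI[of "\<lambda>v. v \<in> P"])
  then obtain c where c: "c \<noteq> 0" "coords P = (\<lambda>i. c * v i)"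
    using P by (auto simp: proj_point_def)
  show "P = proj_point (coords P)"
    unfolding c(2) unfolding P proj_point_def
  proof (intro equalityI subsetI; elim CollectE exE conjE)
    fix w d assume "w = (\<lambda>i. d * v i)" "d \<noteq> 0"
    then show "w \<in> {\<lambda>i. e * (c * v i) | e. e \<noteq> 0}"
      using c(1) by (intro CollectI exI[of _ "d / c"]) auto
  next
    fix w d assume "w = (\<lambda>i. d * (c * v i))" "d \<noteq> 0"
    then show "w \<in> {\<lambda>i. e * v i | e. e \<noteq> 0}"
      using c(1) by (intro CollectI exI[of _ "d * c"]) auto
  qed
qed

lemma form_in_vanishing_ideal_iff:
  assumes "X \<subseteq> proj_space N" "g \<in> forms N d"
  shows "g \<in> vanishing_ideal N X \<longleftrightarrow> (\<forall>P\<in>X. eval_at (coords P) g = 0)"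
proof
  assume "g \<in> vanishing_ideal N X"
  then show "\<forall>P\<in>X. eval_at (coords P) g = 0"
    using assms(1) coords_mem(1) by (auto simp: vanishing_ideal_def)
next
  assume *: "\<forall>P\<in>X. eval_at (coords P) g = 0"
  have "eval_at v g = 0" if P: "P \<in> X" "v \<in> P" for P v
  proof -
    obtain c where "v = (\<lambda>i. c * coords P i)"
      using coords_mem(2)[of P N] P assms(1) by (auto simp: proj_point_def)
    then show ?thesis
      using * P(1) eval_at_scaled_form[OF assms(2)] by simp
  qed
  then show "g \<in> vanishing_ideal N X"
    using assms(2) by (auto simp: vanishing_ideal_def forms_def)
qed

section \<open>The differential action\<close>

lemma lookup_partial_deriv:
  "Poly_Mapping.lookup (partial_deriv i p) m =
     of_nat (Poly_Mapping.lookup m i + 1) * Poly_Mapping.lookup p (m + Poly_Mapping.single i 1)"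
proof -
  have eq: "a - Poly_Mapping.single i 1 = m \<longleftrightarrow> a = m + Poly_Mapping.single i 1"
    if "Poly_Mapping.lookup a i \<noteq> 0" for a :: mono
  proof
    assume "a - Poly_Mapping.single i 1 = m"
    then show "a = m + Poly_Mapping.single i 1"
      using that
      by (intro poly_mapping_eqI) (auto simp: lookup_add lookup_minus lookup_single when_def)
  qed simp
  have "Poly_Mapping.lookup (partial_deriv i p) m = (\<Sum>a\<in>Poly_Mapping.keys p.
      if a = m + Poly_Mapping.single i 1
      then of_nat (Poly_Mapping.lookup m i + 1) * Poly_Mapping.lookup p a else 0)"
    unfolding partial_deriv_def lookup_sum
  proof (rule sum.cong)
    fix a assume "a \<in> Poly_Mapping.keys p"
    show "Poly_Mapping.lookup (Poly_Mapping.single (a - Poly_Mapping.single i 1)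
        (of_nat (Poly_Mapping.lookup a i) * Poly_Mapping.lookup p a)) m =
      (if a = m + Poly_Mapping.single i 1
       then of_nat (Poly_Mapping.lookup m i + 1) * Poly_Mapping.lookup p a else 0)"
      using eq[of a]
      by (cases "Poly_Mapping.lookup a i = 0") (auto simp: lookup_single lookup_add when_def)
  qed simp
  also have "\<dots> = of_nat (Poly_Mapping.lookup m i + 1) *
      Poly_Mapping.lookup p (m + Poly_Mapping.single i 1)"
    by (auto simp: in_keys_iff)
  finally show ?thesis .
qed

text \<open>
  Differentiating \<open>k\<close> times in a variable absent from \<open>m\<close> multiplies by \<open>1 \<cdot> 2 \<cdots> k\<close>. The
  hypothesis makes the product a factorial; it holds at every stage of an iterated derivative
  whose constant coefficient is wanted.
\<close>

lemma lookup_partial_deriv_power: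
  assumes "Poly_Mapping.lookup m i = 0"
  shows "Poly_Mapping.lookup ((partial_deriv i ^^ k) p) m =
     fact k * Poly_Mapping.lookup p (m + Poly_Mapping.single i k)"
proof -
  \<comment> \<open>The inner derivatives are read at exponent \<open>l\<close> of the variable \<open>i\<close>, hence the generalisation.\<close>
  have "Poly_Mapping.lookup ((partial_deriv i ^^ k) p) (m + Poly_Mapping.single i l) * fact l =
     fact (k + l) * Poly_Mapping.lookup p (m + Poly_Mapping.single i (k + l))" for l
  proof (induction k arbitrary: l)
    case (Suc k)
    show ?case
      using Suc[of "Suc l"] assms
      by (simp add: lookup_partial_deriv lookup_add add.assoc single_add[symmetric] mult_ac)
  qed simp
  from this[of 0] show ?thesis
    by simp
qed

text \<open>
  The constant coefficient of a derivative sees a single coefficient of the polynomial, so a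
  form of degree \<open>4\<close> acts on a quartic as a linear functional that can be read off from the
  coefficients of both.
\<close>

lemma lookup_mono_deriv_0:
  "Poly_Mapping.lookup (mono_deriv a p) 0 =
     (\<Prod>i\<in>Poly_Mapping.keys a. fact (Poly_Mapping.lookup a i)) * Poly_Mapping.lookup p a"
proof -
  \<comment> \<open>For a general list and monomial, since each step of the recursion moves a power into \<open>m\<close>.\<close>
  have "Poly_Mapping.lookup (foldr (\<lambda>i. partial_deriv i ^^ Poly_Mapping.lookup a i) xs p) m =
     (\<Prod>i\<leftarrow>xs. fact (Poly_Mapping.lookup a i)) *
     Poly_Mapping.lookup p (m + (\<Sum>i\<leftarrow>xs. Poly_Mapping.single i (Poly_Mapping.lookup a i)))"
    if "distinct xs" "\<forall>i\<in>set xs. Poly_Mapping.lookup m i = 0" for xs m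
    using that
  proof (induction xs arbitrary: m)
    case (Cons x xs)
    have "\<forall>i\<in>set xs. Poly_Mapping.lookup (m + Poly_Mapping.single x (Poly_Mapping.lookup a x)) i = 0"
      using Cons.prems by (auto simp: lookup_add lookup_single when_def)
    then show ?case
      using Cons by (simp add: lookup_partial_deriv_power add.assoc)
  qed simp
  from this[of "sorted_list_of_set (Poly_Mapping.keys a)" 0] show ?thesis
    using sum_of_monomials[of a]
    by (simp add: mono_deriv_def sum_list_distinct_conv_sum_set prod.distinct_set_conv_list[symmetric])
qed

section \<open>Linear algebra\<close>

text \<open>
  Gaussian elimination, one equation at a time: a variable that occurs in the equation is
  expressed by the others and substituted. All dimension counts below, both for uniqueness of
  the dimension of a quotient and for forms on finite sets of points, come from this fact.
\<close>

lemma underdetermined_system_solvable: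
  fixes a :: "'i \<Rightarrow> 'j \<Rightarrow> 'a :: field"
  assumes "finite I" "finite J" "card I < card J"
  shows "\<exists>x. (\<exists>j\<in>J. x j \<noteq> 0) \<and> (\<forall>i\<in>I. (\<Sum>j\<in>J. x j * a i j) = 0)"
  using assms
proof (induction I arbitrary: J a rule: finite_induct)
  case empty
  then have "J \<noteq> {}" by auto
  then show ?case by (intro exI[of _ "\<lambda>_. 1"]) auto
next
  case (insert i I)
  show ?case
  proof (cases "\<forall>j\<in>J. a i j = 0")
    case True
    obtain x where "\<exists>j\<in>J. x j \<noteq> 0" "\<forall>i\<in>I. (\<Sum>j\<in>J. x j * a i j) = 0"
      using insert.IH[of J a] insert.prems insert.hyps by auto
    then show ?thesis
      using True by (intro exI[of _ x]) auto
  next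
    case False
    then obtain p where p: "p \<in> J" "a i p \<noteq> 0" by auto
    define a' where "a' k j = a k j - a k p * a i j / a i p" for k j
    have card: "card I < card (J - {p})"
      using insert p by simp
    obtain x where x: "\<exists>j\<in>J-{p}. x j \<noteq> 0" "\<forall>k\<in>I. (\<Sum>j\<in>J-{p}. x j * a' k j) = 0"
      using insert.IH[of "J - {p}" a'] insert.prems card by auto
    \<comment> \<open>The value at the pivot is the one forced by equation \<open>i\<close>.\<close>
    define y where "y = x(p := - (\<Sum>j\<in>J-{p}. x j * a i j) / a i p)"
    have y: "(\<Sum>j\<in>J. y j * a k j) = (\<Sum>j\<in>J-{p}. x j * a' k j)" for k
    proof -
      have "(\<Sum>j\<in>J. y j * a k j) = y p * a k p + (\<Sum>j\<in>J-{p}. x j * a k j)"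
        using insert.prems(1) p(1) by (simp add: sum.remove y_def)
      also have "y p * a k p = - (\<Sum>j\<in>J-{p}. x j * (a k p * a i j / a i p))"
        by (simp add: y_def sum_distrib_left sum_divide_distrib mult_ac)
      finally show ?thesis
        by (simp add: a'_def right_diff_distrib sum_subtractf)
    qed
    have "a' i j = 0" for j
      using p by (simp add: a'_def)
    then have "\<forall>k\<in>insert i I. (\<Sum>j\<in>J. y j * a k j) = 0"
      using x(2) by (simp add: y)
    moreover have "\<exists>j\<in>J. y j \<noteq> 0"
      using x(1) by (auto simp: y_def)
    ultimately show ?thesis by blast
  qed
qed

definition lin_subspace :: "cpoly set \<Rightarrow> bool" where
  "lin_subspace W \<longleftrightarrow>
     0 \<in> W \<and> (\<forall>p\<in>W. \<forall>q\<in>W. p + q \<in> W) \<and> (\<forall>c. \<forall>p\<in>W. const c * p \<in> W)"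

definition spans_mod :: "cpoly set \<Rightarrow> cpoly set \<Rightarrow> ('j \<Rightarrow> cpoly) \<Rightarrow> 'j set \<Rightarrow> bool" where
  "spans_mod W V b J \<longleftrightarrow> (\<forall>v\<in>V. \<exists>c. v - (\<Sum>j\<in>J. const (c j) * b j) \<in> W)"

definition indep_mod :: "cpoly set \<Rightarrow> ('j \<Rightarrow> cpoly) \<Rightarrow> 'j set \<Rightarrow> bool" where
  "indep_mod W b J \<longleftrightarrow> (\<forall>c. (\<Sum>j\<in>J. const (c j) * b j) \<in> W \<longrightarrow> (\<forall>j\<in>J. c j = 0))"

lemma indep_modD:
  "indep_mod W b J \<Longrightarrow> (\<Sum>j\<in>J. const (c j) * b j) \<in> W \<Longrightarrow> j \<in> J \<Longrightarrow> c j = 0"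
  by (auto simp: indep_mod_def)

lemma lin_subspace_sum:
  "lin_subspace W \<Longrightarrow> (\<And>x. x \<in> A \<Longrightarrow> f x \<in> W) \<Longrightarrow> sum f A \<in> W"
  by (induction A rule: infinite_finite_induct) (auto simp: lin_subspace_def)

lemma lin_subspace_diff:
  "lin_subspace W \<Longrightarrow> p \<in> W \<Longrightarrow> q \<in> W \<Longrightarrow> p - q \<in> W"
proof -
  assume "lin_subspace W" "p \<in> W" "q \<in> W"
  then have "p + const (- 1) * q \<in> W"
    by (auto simp: lin_subspace_def)
  then show "p - q \<in> W"
    by (simp add: const_uminus)
qed

text \<open>
  The exchange inequality in \<open>V / W\<close>. With fewer spanning than independent elements, the matrix
  that expresses the latter by the former has a nontrivial kernel, which is a relation modulo
  \<open>W\<close>.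
\<close>

lemma card_indep_le_card_span:
  assumes W: "lin_subspace W" and fin: "finite J" "finite K"
    and span: "spans_mod W V b J" and indep: "indep_mod W e K" and e: "e ` K \<subseteq> V"
  shows "card K \<le> card J"
proof (rule ccontr)
  assume "\<not> card K \<le> card J"
  then have less: "card J < card K" by simp
  have "\<exists>c. e k - (\<Sum>j\<in>J. const (c j) * b j) \<in> W" if "k \<in> K" for k
    using span e that by (auto simp: spans_mod_def)
  then obtain a where a: "\<And>k. k \<in> K \<Longrightarrow> e k - (\<Sum>j\<in>J. const (a k j) * b j) \<in> W"
    by metis
  obtain x where x: "\<exists>k\<in>K. x k \<noteq> 0" "\<forall>j\<in>J. (\<Sum>k\<in>K. x k * a k j) = 0"
    using underdetermined_system_solvable[OF fin less, of "\<lambda>j k. a k j"] by auto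
  have "(\<Sum>k\<in>K. const (x k) * (\<Sum>j\<in>J. const (a k j) * b j))
      = (\<Sum>j\<in>J. const (\<Sum>k\<in>K. x k * a k j) * b j)"
    by (simp add: const_sum const_mult sum_distrib_left sum_distrib_right mult_ac)
       (rule sum.swap)
  also have "\<dots> = 0"
    using x(2) by simp
  finally have "(\<Sum>k\<in>K. const (x k) * e k) =
      (\<Sum>k\<in>K. const (x k) * (e k - (\<Sum>j\<in>J. const (a k j) * b j)))"
    by (simp add: right_diff_distrib sum_subtractf)
  also have "\<dots> \<in> W"
    using W a by (intro lin_subspace_sum) (auto simp: lin_subspace_def)
  finally show False
    using indep x(1) by (auto simp: indep_mod_def)
qed

text \<open>
  Any basis of the quotient, over any finite index set, determines \<^const>\<open>quot_dim\<close>: it can be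
  renumbered to have the required form, and no other length occurs, by the exchange
  inequality in both directions.
\<close>

lemma quot_dim_eq_card:
  assumes V: "lin_subspace V" and W: "lin_subspace W" and "finite J"
    and b: "b ` J \<subseteq> V" and span: "spans_mod W V b J" and indep: "indep_mod W b J"
  shows "quot_dim V W = card J"
  unfolding quot_dim_def
proof (rule the_equality)
  obtain h where h: "bij_betw h {..<card J} J"
    using ex_bij_betw_nat_finite[OF \<open>finite J\<close>] by (auto simp: lessThan_atLeast0)
  let ?h' = "the_inv_into {..<card J} h"
  have re: "(\<Sum>j<card J. const (c j) * b (h j)) = (\<Sum>j\<in>J. const (c (?h' j)) * b j)" for c
    using h sum.reindex_bij_betw[OF h, of "\<lambda>j. const (c (?h' j)) * b j"]
    by (simp add: the_inv_into_f_f bij_betw_def)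
  have "\<exists>!c. (\<forall>j\<ge>card J. c j = 0) \<and> v - (\<Sum>j<card J. const (c j) * b (h j)) \<in> W"
    if v: "v \<in> V" for v
  proof -
    obtain c where c: "v - (\<Sum>j\<in>J. const (c j) * b j) \<in> W"
      using span v by (auto simp: spans_mod_def)
    have "(\<Sum>j<card J. const (c (h j)) * b (h j)) = (\<Sum>j\<in>J. const (c j) * b j)"
      by (rule sum.reindex_bij_betw[OF h])
    then have c': "v - (\<Sum>j<card J. const (if j < card J then c (h j) else 0) * b (h j)) \<in> W"
      using c by simp
    show ?thesis
    proof (rule ex1I[of _ "\<lambda>j. if j < card J then c (h j) else 0"])
      fix d
      assume d: "(\<forall>j\<ge>card J. d j = 0) \<and> v - (\<Sum>j<card J. const (d j) * b (h j)) \<in> W"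
      define x where "x j = d j - (if j < card J then c (h j) else 0)" for j
      have "(\<Sum>j<card J. const (x j) * b (h j)) \<in> W"
        using lin_subspace_diff[OF W c' conjunct2[OF d]]
        by (simp add: x_def const_diff left_diff_distrib sum_subtractf)
      then have "x (?h' j) = 0" if "j \<in> J" for j
        using indep_modD[OF indep, of "\<lambda>j. x (?h' j)"] that by (simp add: re)
      moreover have "h j \<in> J" "?h' (h j) = j" if "j < card J" for j
        using h that by (auto simp: bij_betw_def the_inv_into_f_f)
      ultimately have "x j = 0" if "j < card J" for j
        using that by metis
      then show "d = (\<lambda>j. if j < card J then c (h j) else 0)"
        using d by (auto simp: x_def fun_eq_iff)
    qed (use c' in auto)
  qed
  moreover have "\<forall>j<card J. b (h j) \<in> V"
    using b h by (auto simp: bij_betw_def)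
  ultimately show "\<exists>e. (\<forall>j<card J. e j \<in> V) \<and>
      (\<forall>v\<in>V. \<exists>!c. (\<forall>j\<ge>card J. c j = 0) \<and> v - (\<Sum>j<card J. const (c j) * e j) \<in> W)"
    by (intro exI[of _ "\<lambda>j. b (h j)"]) blast
next
  fix k :: nat
  assume "\<exists>e. (\<forall>j<k. e j \<in> V) \<and>
      (\<forall>v\<in>V. \<exists>!c. (\<forall>j\<ge>k. c j = 0) \<and> v - (\<Sum>j<k. const (c j) * e j) \<in> W)"
  then obtain e where e: "\<forall>j<k. e j \<in> V"
    and ex1: "\<forall>v\<in>V. \<exists>!c. (\<forall>j\<ge>k. c j = 0) \<and> v - (\<Sum>j<k. const (c j) * e j) \<in> W"
    by (elim exE conjE) (rule that)
  have span': "spans_mod W V e {..<k}"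
    unfolding spans_mod_def
  proof
    fix v assume "v \<in> V"
    from bspec[OF ex1 this] show "\<exists>c. v - (\<Sum>j<k. const (c j) * e j) \<in> W"
      by (elim ex1E conjE) (rule exI)
  qed
  have indep': "indep_mod W e {..<k}"
    unfolding indep_mod_def
  proof (intro allI impI ballI)
    fix c j
    assume c: "(\<Sum>j<k. const (c j) * e j) \<in> W" and j: "j \<in> {..<k}"
    let ?c = "\<lambda>j. if j < k then - c j else 0"
    have "0 \<in> V"
      using V by (simp add: lin_subspace_def)
    \<comment> \<open>Independence is uniqueness of the coefficients that represent \<open>0\<close>.\<close>
    from bspec[OF ex1 this] obtain c0 where c0:
      "\<And>d. (\<forall>j\<ge>k. d j = 0) \<and> 0 - (\<Sum>j<k. const (d j) * e j) \<in> W \<Longrightarrow> d = c0"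
      by (elim ex1E) blast
    have "?c = c0"
      using c by (intro c0) (auto simp: const_uminus sum_negf dest: leD)
    moreover have "(\<lambda>_. 0) = c0"
      using W by (intro c0) (simp add: lin_subspace_def)
    ultimately have "?c = (\<lambda>_. 0)"
      by simp
    then show "c j = 0"
      using j by (auto simp: fun_eq_iff split: if_splits)
  qed
  have "card J \<le> card {..<k}"
    using card_indep_le_card_span[OF W _ _ span' indep b] \<open>finite J\<close> by simp
  moreover have "card {..<k} \<le> card J"
    using card_indep_le_card_span[OF W _ _ span indep'] e \<open>finite J\<close> by auto
  ultimately show "k = card J"
    by simp
qed

section \<open>Finite sets of points\<close>

lemma lin_subspace_forms: "lin_subspace (forms N d)"
  by (simp add: lin_subspace_def forms_add forms_const_mult)

lemma forms_in_vanishing_ideal_eq: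
  assumes "X \<subseteq> proj_space N"
  shows "vanishing_ideal N X \<inter> forms N d = {g \<in> forms N d. \<forall>P\<in>X. eval_at (coords P) g = 0}"
  using form_in_vanishing_ideal_iff[OF assms] by blast

lemma lin_subspace_vanishing_forms:
  assumes "X \<subseteq> proj_space N"
  shows "lin_subspace (vanishing_ideal N X \<inter> forms N d)"
  unfolding forms_in_vanishing_ideal_eq[OF assms]
  using lin_subspace_forms[of N d] by (auto simp: lin_subspace_def)

text \<open>
  Modulo the vanishing ideal, a form is its vector of values at the points, that is, an element
  of a space of dimension at most \<^term>\<open>card X\<close>.
\<close>

lemma card_indep_forms_le_card_points:
  assumes X: "finite X" "X \<subseteq> proj_space N" and "finite J" and b: "b ` J \<subseteq> forms N d"
    and indep: "indep_mod (vanishing_ideal N X \<inter> forms N d) b J"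
  shows "card J \<le> card X"
proof (rule ccontr)
  assume "\<not> card J \<le> card X"
  then have "card X < card J" by simp
  then obtain x where x: "\<exists>j\<in>J. x j \<noteq> 0" "\<forall>P\<in>X. (\<Sum>j\<in>J. x j * eval_at (coords P) (b j)) = 0"
    using underdetermined_system_solvable[OF X(1) \<open>finite J\<close>, of "\<lambda>P j. eval_at (coords P) (b j)"]
    by auto
  have "(\<Sum>j\<in>J. const (x j) * b j) \<in> vanishing_ideal N X \<inter> forms N d"
    unfolding forms_in_vanishing_ideal_eq[OF X(2)] using b x(2)
    by (auto simp: eval_at_sum intro!: forms_sum forms_const_mult)
  then show False
    using indep x(1) by (auto simp: indep_mod_def)
qed

text \<open>
  As many independent forms as points exhaust all functions on the points: adding one more form
  \<open>g\<close> (the index \<^const>\<open>None\<close>) forces a relation between the values, and independence makes the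
  coefficient of \<open>g\<close> in it nonzero.
\<close>

lemma indep_forms_span:
  assumes X: "finite X" "X \<subseteq> proj_space N" and "finite J" and b: "b ` J \<subseteq> forms N d"
    and indep: "indep_mod (vanishing_ideal N X \<inter> forms N d) b J" and card: "card X \<le> card J"
  shows "spans_mod (vanishing_ideal N X \<inter> forms N d) (forms N d) b J"
  unfolding spans_mod_def
proof
  fix g assume g: "g \<in> forms N d"
  define e where "e o' = (case o' of None \<Rightarrow> g | Some j \<Rightarrow> b j)" for o'
  let ?K = "insert None (Some ` J)"
  have "card X < card ?K"
    using card \<open>finite J\<close> by (simp add: card_image)
  then obtain x where x: "\<exists>o'\<in>?K. x o' \<noteq> 0"
      "\<forall>P\<in>X. (\<Sum>o'\<in>?K. x o' * eval_at (coords P) (e o')) = 0"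
    using underdetermined_system_solvable[OF X(1), of ?K "\<lambda>P o'. eval_at (coords P) (e o')"]
      \<open>finite J\<close> by auto
  have x2: "x None * eval_at (coords P) g + (\<Sum>j\<in>J. x (Some j) * eval_at (coords P) (b j)) = 0"
    if "P \<in> X" for P
  proof -
    have "(\<Sum>o'\<in>?K. x o' * eval_at (coords P) (e o')) =
        x None * eval_at (coords P) g + (\<Sum>j\<in>J. x (Some j) * eval_at (coords P) (b j))"
      using \<open>finite J\<close> by (subst sum.insert) (auto simp: e_def sum.reindex)
    then show ?thesis
      using x(2) that by simp
  qed
  have "x None \<noteq> 0"
  proof
    assume 0: "x None = 0"
    then have "(\<Sum>j\<in>J. const (x (Some j)) * b j) \<in> vanishing_ideal N X \<inter> forms N d"
      unfolding forms_in_vanishing_ideal_eq[OF X(2)] using b x2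
      by (auto simp: eval_at_sum intro!: forms_sum forms_const_mult)
    then have "\<forall>j\<in>J. x (Some j) = 0"
      using indep by (auto simp: indep_mod_def)
    then show False
      using x(1) 0 by auto
  qed
  have "eval_at (coords P) (g - (\<Sum>j\<in>J. const (- x (Some j) / x None) * b j)) = 0"
    if "P \<in> X" for P
  proof -
    have "eval_at (coords P) (\<Sum>j\<in>J. const (- x (Some j) / x None) * b j) =
        - (\<Sum>j\<in>J. x (Some j) * eval_at (coords P) (b j)) / x None"
      by (simp add: eval_at_sum sum_divide_distrib sum_negf)
    moreover have "(\<Sum>j\<in>J. x (Some j) * eval_at (coords P) (b j)) = - (x None * eval_at (coords P) g)"
      using x2[OF that] by (simp add: eq_neg_iff_add_eq_0 add.commute)
    ultimately show ?thesis
      using \<open>x None \<noteq> 0\<close> by simp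
  qed
  moreover have "g - (\<Sum>j\<in>J. const (- x (Some j) / x None) * b j) \<in> forms N d"
    using g b by (intro forms_diff forms_sum forms_const_mult) auto
  ultimately have "g - (\<Sum>j\<in>J. const (- x (Some j) / x None) * b j) \<in> vanishing_ideal N X \<inter> forms N d"
    unfolding forms_in_vanishing_ideal_eq[OF X(2)] by simp
  then show "\<exists>c. g - (\<Sum>j\<in>J. const (c j) * b j) \<in> vanishing_ideal N X \<inter> forms N d"
    by (rule exI[of _ "\<lambda>j. - x (Some j) / x None"])
qed

section \<open>The quartic as a functional on forms\<close>

text \<open>
  In this and the following sections the \<open>y\<close>-variables are counted from \<open>0\<close>: \<open>Y\<^sub>k\<close> is the
  variable with index \<open>k + 2\<close>, for \<open>k < n\<close>, and \<open>X\<^sub>1\<close>, \<open>X\<^sub>2\<close> have index \<open>0\<close> and \<open>1\<close>. The \<open>apex j\<close> are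
  the exponents of the monomials \<open>x\<^sub>1 x\<^sub>2 y\<^sub>j\<^sup>2\<close> of the quartic.
\<close>

definition apex :: "nat \<Rightarrow> mono" where
  "apex j = Poly_Mapping.single 0 1 + Poly_Mapping.single 1 1 + Poly_Mapping.single (j + 2) 2"

definition F_pairing :: "nat \<Rightarrow> cpoly \<Rightarrow> complex" where
  "F_pairing n g = (\<Sum>j<n. Poly_Mapping.lookup g (apex j))"

lemma F_quadric_products: "F_quadric n = (\<Sum>j<n. Var 0 * Var 1 * Var (j + 2) ^ 2)"
proof -
  have "(\<Sum>j=1..n. Var (j + 1) ^ 2) = (\<Sum>j<n. Var (j + 2) ^ 2)"
    using sum.shift_bounds_Suc_ivl[of "\<lambda>j. Var (j + 1) ^ 2" 0 n]
    by (simp add: lessThan_atLeast0 atLeastLessThanSuc_atLeastAtMost)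
  then show ?thesis
    by (simp add: F_quadric_def sum_distrib_left)
qed

lemma F_quadric_monomials: "F_quadric n = (\<Sum>j<n. Poly_Mapping.single (apex j) 1)"
  unfolding F_quadric_products
  by (simp add: Var_def power2_eq_square mult_single apex_def single_add[symmetric] numeral_2_eq_2)

text \<open>
  The factor \<open>2\<close> is \<open>1! 1! 2!\<close>, the same for all monomials of the quartic. Thus
  \<^const>\<open>F_pairing\<close> is, up to this factor, the action on the quartic followed by taking the
  constant coefficient.
\<close>

lemma lookup_diff_act_F_quadric:
  "Poly_Mapping.lookup (g \<circ>\<^sub>D F_quadric n) 0 = 2 * F_pairing n g"
proof -
  define w :: "mono \<Rightarrow> complex"
    where "w a = (\<Prod>i\<in>Poly_Mapping.keys a. fact (Poly_Mapping.lookup a i))" for a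
  have w: "w (apex j) = 2" for j
  proof -
    have "w (apex j) = (\<Prod>i\<in>{0, 1, j + 2}. fact (Poly_Mapping.lookup (apex j) i))"
      unfolding w_def by (rule prod.mono_neutral_left)
        (auto simp: in_keys_iff apex_def lookup_add lookup_single when_def split: if_splits)
    then show ?thesis
      by (simp add: apex_def lookup_add lookup_single numeral_2_eq_2)
  qed
  have "Poly_Mapping.lookup (g \<circ>\<^sub>D F_quadric n) 0 =
      (\<Sum>a\<in>Poly_Mapping.keys g. Poly_Mapping.lookup g a * (w a * (\<Sum>j<n. 1 when apex j = a)))"
    by (simp add: diff_act_def lookup_sum lookup_mono_deriv_0 w_def F_quadric_monomials lookup_single)
  also have "\<dots> = (\<Sum>j<n. \<Sum>a\<in>Poly_Mapping.keys g.
      if a = apex j then Poly_Mapping.lookup g a * w a else 0)"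
    by (subst sum.swap) (auto simp: sum_distrib_left when_def intro!: sum.cong)
  also have "\<dots> = (\<Sum>j<n. Poly_Mapping.lookup g (apex j) * w (apex j))"
    by (rule sum.cong) (auto simp: in_keys_iff)
  also have "\<dots> = 2 * F_pairing n g"
    by (simp add: w F_pairing_def sum_distrib_left mult.commute)
  finally show ?thesis .
qed

text \<open>
  Apolarity enters through this functional. Applied to the multiples of a polynomial it carries the information of the whole ideal \<open>F\<^sup>\<bottom>\<close>.
\<close>

lemma F_pairing_vanishing_ideal:
  assumes "apolar_set N (F_quadric n) X" "g \<in> vanishing_ideal N X"
  shows "F_pairing n g = 0"
proof -
  have "g \<circ>\<^sub>D F_quadric n = 0"
    using assms by (auto simp: apolar_set_def perp_def)
  then show ?thesis
    using lookup_diff_act_F_quadric[of g n] by simp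
qed

lemma F_pairing_simps [simp]:
  "F_pairing n 0 = 0"
  "F_pairing n (p + q) = F_pairing n p + F_pairing n q"
  "F_pairing n (p - q) = F_pairing n p - F_pairing n q"
  "F_pairing n (const c * p) = c * F_pairing n p"
  by (simp_all add: F_pairing_def lookup_add lookup_minus sum.distrib sum_subtractf sum_distrib_left)

lemma F_pairing_sum: "F_pairing n (sum f A) = (\<Sum>x\<in>A. F_pairing n (f x))"
  by (induction A rule: infinite_finite_induct) simp_all

text \<open>
  No monomial of the quartic contains two different \<open>y\<close>-variables, and dividing the ones that
  contain \<open>y\<^sub>i\<^sup>2\<close> by it leaves \<open>x\<^sub>1 x\<^sub>2\<close>. So multiplication by quadrics in the \<open>Y\<^sub>k\<close> turns the
  pairing into the standard scalar product on linear forms in the \<open>Y\<^sub>k\<close>.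
\<close>

lemma F_pairing_yy:
  assumes "i < n" "k < n"
  shows "F_pairing n (Var (i + 2) * (Var (k + 2) * r)) =
    (if i = k then Poly_Mapping.lookup r (Poly_Mapping.single 0 1 + Poly_Mapping.single 1 1) else 0)"
proof -
  have "Poly_Mapping.lookup (Var (i + 2) * (Var (k + 2) * r)) (apex j) =
     (if j = i then if i = k
       then Poly_Mapping.lookup r (Poly_Mapping.single 0 1 + Poly_Mapping.single 1 1) else 0 else 0)"
    for j
  proof (cases "j = i \<and> j = k")
    case True
    have "apex k - Poly_Mapping.single (k + 2) 1 - Poly_Mapping.single (k + 2) 1 =
        Poly_Mapping.single 0 1 + Poly_Mapping.single 1 1"
      by (rule poly_mapping_eqI) (auto simp: apex_def lookup_add lookup_minus lookup_single when_def)
    moreover have jk: "j = k" "i = k"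
      using True by auto
    ultimately show ?thesis
      unfolding jk lookup_Var_mult
      by (simp add: apex_def lookup_add lookup_minus lookup_single when_def)
  next
    case False
    then show ?thesis
      by (auto simp: lookup_Var_mult apex_def lookup_add lookup_minus lookup_single when_def)
  qed
  then show ?thesis
    using assms by (simp add: F_pairing_def)
qed

lemma F_pairing_xx:
  "i < 2 \<Longrightarrow> F_pairing n (Var i * (Var i * r)) = 0"
  by (auto simp: F_pairing_def lookup_Var_mult apex_def lookup_add lookup_minus lookup_single
      when_def less_2_cases_iff)

section \<open>A sum of fourth powers\<close>

lemma signed_fourth_powers:
  fixes a b z :: "'a :: comm_ring_1"
  shows "(a + b + z) ^ 4 - (a - b + z) ^ 4 - (z - a + b) ^ 4 + (z - a - b) ^ 4 =
    48 * (a * b * z ^ 2) + 16 * (a ^ 3 * b + a * b ^ 3)"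
  by (simp add: power4_eq_xxxx power3_eq_cube power2_eq_square algebra_simps)

text \<open>
  With \<open>z = c y\<^sub>j\<close>, the signed sum of four fourth powers is \<open>x\<^sub>1 x\<^sub>2 y\<^sub>j\<^sup>2\<close> up to a factor, plus a
  multiple of \<open>x\<^sub>1\<^sup>3 x\<^sub>2 + x\<^sub>1 x\<^sub>2\<^sup>3\<close> that does not depend on \<open>j\<close>. Scaling \<open>y\<^sub>j\<close> makes the weight \<open>w j\<close> of
  this error term an arbitrary nonzero number, and as soon as \<open>n \<ge> 2\<close> there are nonzero weights
  with sum zero, for which the errors cancel: four powers for each of the \<open>n\<close> summands suffice.
\<close>

lemma waring_rank_F_quadric_le:
  assumes "n \<ge> 2"
  shows "waring_rank (n + 2) (F_quadric n) \<le> 4 * n"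
proof -
  have form: "F_quadric n \<in> forms (n + 2) 4"
  proof -
    have deg4: "1 + 1 + 2 * 1 = (4 :: nat)"
      by simp
    have "Var 0 * Var 1 * Var (j + 2) ^ 2 \<in> forms (n + 2) (1 + 1 + 2 * 1)" if "j < n" for j
      using that by (intro forms_mult forms_power forms_Var) auto
    then show ?thesis
      unfolding F_quadric_products deg4 by (intro forms_sum) (simp only: lessThan_iff)
  qed
  have "Poly_Mapping.lookup (F_quadric n) (apex 0) \<noteq> 0"
  proof -
    have "apex j = apex 0 \<longleftrightarrow> j = 0" for j
    proof
      assume "apex j = apex 0"
      then have "Poly_Mapping.lookup (apex j) 2 = Poly_Mapping.lookup (apex 0) 2"
        by simp
      then show "j = 0"
        by (auto simp: apex_def lookup_add lookup_single when_def split: if_splits)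
    qed simp
    then show ?thesis
      using assms by (simp add: F_quadric_monomials lookup_sum lookup_single when_def)
  qed
  then have "F_quadric n \<noteq> 0"
    by (metis lookup_zero)
  then have deg: "total_degree (F_quadric n) = 4"
    by (rule total_degree_form[OF form])
  define w :: "nat \<Rightarrow> complex" where "w j = (if j = n - 1 then - of_nat (n - 1) else 1)" for j
  have w0: "w j \<noteq> 0" for j
    using assms by (auto simp: w_def)
  have "{..<n} = insert (n - 1) {..<n - 1}"
    using assms by auto
  then have wsum: "(\<Sum>j<n. w j) = 0"
    by (simp add: w_def)
  \<comment> \<open>The square of the scaling factor undoes the weight in the term \<open>x\<^sub>1 x\<^sub>2 y\<^sub>j\<^sup>2\<close>.\<close>
  define z where "z j = const (csqrt (1 / w j)) * Var (j + 2)" for j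
  define L where "L i = (let z = z (i div 4) in
     [Var 0 + Var 1 + z, Var 0 - Var 1 + z, z - Var 0 + Var 1, z - Var 0 - Var 1] ! (i mod 4))" for i
  define \<alpha> where "\<alpha> i = w (i div 4) / 48 * [1, -1, -1, 1] ! (i mod 4)" for i
  have L: "\<forall>i<4 * n. L i \<in> forms (n + 2) 1"
  proof (intro allI impI)
    fix i assume "i < 4 * n"
    then have "z (i div 4) \<in> forms (n + 2) 1"
      unfolding z_def by (intro forms_const_mult forms_Var) auto
    moreover have "Var 0 \<in> forms (n + 2) 1" "Var 1 \<in> forms (n + 2) 1"
      by (rule forms_Var, simp)+
    moreover have "i mod 4 \<in> {0, 1, 2, 3}"
      by auto
    ultimately show "L i \<in> forms (n + 2) 1"
      by (auto simp: L_def Let_def numeral_2_eq_2 numeral_3_eq_3 intro!: forms_add forms_diff)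
  qed
  have block: "(\<Sum>i=j*4..<j*4+4. const (\<alpha> i) * L i ^ 4) =
      Var 0 * Var 1 * Var (j + 2) ^ 2 + const (w j / 3) * (Var 0 ^ 3 * Var 1 + Var 0 * Var 1 ^ 3)"
    for j
  proof -
    have "{j*4..<j*4+4} = {j*4, j*4+1, j*4+2, j*4+3}"
      by auto
    then have "(\<Sum>i=j*4..<j*4+4. const (\<alpha> i) * L i ^ 4) =
       const (w j / 48) * ((Var 0 + Var 1 + z j) ^ 4 - (Var 0 - Var 1 + z j) ^ 4
         - (z j - Var 0 + Var 1) ^ 4 + (z j - Var 0 - Var 1) ^ 4)"
      by (simp add: \<alpha>_def L_def Let_def const_uminus algebra_simps mod_Suc div_Suc)
    also have "\<dots> = const (w j / 48) * const 48 * const (1 / w j) * (Var 0 * Var 1 * Var (j + 2) ^ 2)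
       + const (w j / 48) * const 16 * (Var 0 ^ 3 * Var 1 + Var 0 * Var 1 ^ 3)"
    proof -
      have "z j ^ 2 = const (1 / w j) * Var (j + 2) ^ 2"
        by (simp add: z_def power_mult_distrib const_power[symmetric])
      then show ?thesis
        unfolding signed_fourth_powers by (simp add: distrib_left mult_ac)
    qed
    also have "const (w j / 48) * const 48 * const (1 / w j) = 1"
      using w0[of j] by (simp add: const_mult[symmetric] del: const_simps(3))
    also have "const (w j / 48) * const 16 = const (w j / 3)"
      by (simp add: const_mult[symmetric] del: const_simps(3))
    finally show ?thesis
      by simp
  qed
  have "(\<Sum>i<4 * n. const (\<alpha> i) * L i ^ 4) = (\<Sum>j<n. \<Sum>i=j*4..<j*4+4. const (\<alpha> i) * L i ^ 4)"
    using sum.nat_group[of "\<lambda>i. const (\<alpha> i) * L i ^ 4" 4 n] by (simp add: mult.commute)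
  also have "\<dots> = F_quadric n + const (\<Sum>j<n. w j / 3) * (Var 0 ^ 3 * Var 1 + Var 0 * Var 1 ^ 3)"
    by (simp only: block sum.distrib F_quadric_products const_sum sum_distrib_right)
  also have "\<dots> = F_quadric n"
    using wsum by (simp add: sum_divide_distrib[symmetric])
  finally show ?thesis
    unfolding waring_rank_def deg using L by (intro Least_le exI[of _ \<alpha>] exI[of _ L]) simp
qed

section \<open>Dual families of forms\<close>

text \<open>
  The products of \<open>1, X\<^sub>1, X\<^sub>2, X\<^sub>1 X\<^sub>2\<close> with \<open>1, Y\<^sub>1, \<dots>, Y\<^sub>n\<^sub>-\<^sub>1\<close> are \<open>4 n\<close> monomials. The triple
  \<open>(a, b, k)\<close> stands for \<open>X\<^sub>1\<^sup>a X\<^sub>2\<^sup>b Y\<^sub>k\<close>, where \<open>k = 0\<close> encodes the factor \<open>1\<close>. The variable \<open>Y\<^sub>0\<close> is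
  left out because the linear form \<open>y_form\<close>, in which it has coefficient \<open>1\<close>, takes its place.
\<close>

definition idx :: "nat \<Rightarrow> (nat \<times> nat \<times> nat) set" where
  "idx n = {..1} \<times> {..1} \<times> {..<n}"

fun idx_deg :: "nat \<times> nat \<times> nat \<Rightarrow> nat" where
  "idx_deg (a, b, k) = a + b + (if k = 0 then 0 else 1)"

fun basis_form :: "nat \<times> nat \<times> nat \<Rightarrow> cpoly" where
  "basis_form (a, b, k) = Var 0 ^ a * Var 1 ^ b * (if k = 0 then 1 else Var (k + 2))"

text \<open>
  The coefficients are powers of one parameter, so that avoiding finitely many points means
  avoiding the roots of finitely many polynomials in \<open>s\<close>.
\<close>

definition y_form :: "nat \<Rightarrow> complex \<Rightarrow> cpoly" where
  "y_form n s = (\<Sum>k<n. const (s ^ k) * Var (k + 2))"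

text \<open>
  These span the linear forms in the \<open>Y\<^sub>k\<close> that are orthogonal to \<open>y_form\<close> for the standard
  bilinear form.
\<close>

definition y_conj :: "complex \<Rightarrow> nat \<Rightarrow> cpoly" where
  "y_conj s k = Var (k + 2) - const (s ^ k) * Var (0 + 2)"

text \<open>
  The factor \<open>X\<^sub>1\<^bsup>1-a\<^esup> X\<^sub>2\<^bsup>1-b\<^esup>\<close> completes the \<open>X\<close>-part to \<open>X\<^sub>1 X\<^sub>2\<close>, and the others complete the
  \<open>Y\<close>-part to a quadric. For \<open>k = 0\<close> the quadric is \<open>(Y\<^sub>1 - s Y\<^sub>0) Y\<^sub>1\<close>, which requires \<open>n \<ge> 2\<close>. A factor
  of the form \<^const>\<open>y_conj\<close> is always present, as it makes the dual form vanish at the points without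
  \<open>y\<close>-coordinates and pair to zero with the multiples of \<^const>\<open>y_form\<close>.
\<close>

fun dual_form :: "complex \<Rightarrow> nat \<times> nat \<times> nat \<Rightarrow> cpoly" where
  "dual_form s (a, b, k) = y_conj s (max 1 k) *
     ((if k = 0 then Var (1 + 2) else 1) * (Var 0 ^ (1 - a) * Var 1 ^ (1 - b)))"

lemma forms_basis_form:
  "j \<in> idx n \<Longrightarrow> basis_form j \<in> forms (n + 2) (idx_deg j)"
proof -
  assume j: "j \<in> idx n"
  obtain a b k where abk: "j = (a, b, k)" by (cases j)
  have "Var 0 ^ a * Var 1 ^ b * (if k = 0 then 1 else Var (k + 2)) \<in>
      forms (n + 2) (a * 1 + b * 1 + (if k = 0 then 0 else 1))"
    using j abk by (intro forms_mult forms_power forms_Var) (auto simp: idx_def)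
  then show ?thesis
    by (simp add: abk)
qed

lemma forms_y_form: "y_form n s \<in> forms (n + 2) 1"
  unfolding y_form_def by (intro forms_sum forms_const_mult forms_Var) auto

lemma forms_y_conj: "k < n \<Longrightarrow> y_conj s k \<in> forms (n + 2) 1"
  unfolding y_conj_def by (intro forms_diff forms_const_mult forms_Var) auto

lemma forms_dual_form:
  assumes "n \<ge> 2" "j \<in> idx n"
  shows "\<exists>d. dual_form s j \<in> forms (n + 2) d"
proof -
  obtain a b k where abk: "j = (a, b, k)" by (cases j)
  have "(if k = 0 then Var (1 + 2) else 1) \<in> forms (n + 2) (if k = 0 then 1 else 0)"
    using assms(1) by auto
  moreover have "max 1 k < n"
    using assms by (auto simp: abk idx_def)
  ultimately show ?thesis
    unfolding abk dual_form.simps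
    by (intro exI[of _ "1 + ((if k = 0 then 1 else 0) + ((1 - a) * 1 + (1 - b) * 1))"]
        forms_mult forms_power forms_Var forms_y_conj) auto
qed

lemma eval_at_y_form: "eval_at v (y_form n s) = (\<Sum>k<n. s ^ k * v (k + 2))"
  by (simp add: y_form_def eval_at_sum)

text \<open>
  Orthogonality: \<open>Y\<^sub>k\<close> and \<open>s\<^sup>k Y\<^sub>0\<close> both have scalar product \<open>s\<^sup>k\<close> with \<open>y_form\<close>.
\<close>

lemma F_pairing_y_conj_y_form:
  assumes "k < n"
  shows "F_pairing n (y_conj s k * (y_form n s * r)) = 0"
proof -
  let ?e = "Poly_Mapping.lookup r (Poly_Mapping.single 0 1 + Poly_Mapping.single 1 1)"
  have *: "F_pairing n (Var (i + 2) * (y_form n s * r)) = s ^ i * ?e" if "i < n" for i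
  proof -
    have "Var (i + 2) * (y_form n s * r) =
        (\<Sum>l<n. const (s ^ l) * (Var (i + 2) * (Var (l + 2) * r)))"
      unfolding y_form_def sum_distrib_left sum_distrib_right by (intro sum.cong refl) (simp add: mult_ac)
    also have "F_pairing n \<dots> = (\<Sum>l<n. if l = i then s ^ i * ?e else 0)"
      unfolding F_pairing_sum F_pairing_simps
      using that by (intro sum.cong refl) (auto simp only: F_pairing_yy lessThan_iff mult_zero_right split: if_split)
    finally show ?thesis
      using that by simp
  qed
  have "y_conj s k * (y_form n s * r) =
      Var (k + 2) * (y_form n s * r) - const (s ^ k) * (Var (0 + 2) * (y_form n s * r))"
    by (simp add: y_conj_def algebra_simps)
  then show ?thesis
    using *[of k] *[of 0] assms by (simp only: F_pairing_simps) simp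
qed

lemma F_pairing_y_conj_y:
  assumes "k < n" "0 < l" "l < n"
  shows "F_pairing n (y_conj s k * (Var (l + 2) * r)) =
    (if k = l then Poly_Mapping.lookup r (Poly_Mapping.single 0 1 + Poly_Mapping.single 1 1) else 0)"
proof -
  have "y_conj s k * (Var (l + 2) * r) =
      Var (k + 2) * (Var (l + 2) * r) - const (s ^ k) * (Var (0 + 2) * (Var (l + 2) * r))"
    by (simp add: y_conj_def algebra_simps)
  then show ?thesis
    using assms by (simp only: F_pairing_simps F_pairing_yy) simp
qed

lemma F_pairing_dual_form_y_form:
  assumes "n \<ge> 2" "j \<in> idx n"
  shows "F_pairing n (dual_form s j * (y_form n s * r)) = 0"
proof -
  obtain a b k where abk: "j = (a, b, k)" by (cases j)
  have "dual_form s j * (y_form n s * r) = y_conj s (max 1 k) * (y_form n s *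
      (((if k = 0 then Var (1 + 2) else 1) * (Var 0 ^ (1 - a) * Var 1 ^ (1 - b))) * r))"
    by (simp add: abk mult_ac)
  moreover have "max 1 k < n"
    using assms by (auto simp: abk idx_def)
  ultimately show ?thesis
    by (simp only: F_pairing_y_conj_y_form)
qed

text \<open>
  If the \<open>X\<close>-parts agree, the pairing is a scalar product of linear forms in the \<open>Y\<^sub>k\<close>. If they
  differ, then either \<open>X\<^sub>1\<close> or \<open>X\<^sub>2\<close> occurs twice in the product, or some \<open>X\<close> is missing from it; in
  the second case equality of the degrees leaves room only for a cubic \<open>Y\<close>-part, which no
  monomial of the quartic contains.
\<close>

lemma F_pairing_dual_form_basis_form:
  assumes n: "n \<ge> 2" and "j \<in> idx n" "j' \<in> idx n" and deg: "idx_deg j = idx_deg j'"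
  shows "F_pairing n (dual_form s j * basis_form j') = (if j = j' then 1 else 0)"
proof -
  obtain a b k where abk: "j = (a, b, k)" by (cases j)
  obtain a' b' k' where abk': "j' = (a', b', k')" by (cases j')
  have le: "a \<le> 1" "b \<le> 1" "a' \<le> 1" "b' \<le> 1" "max 1 k < n" "max 1 k' < n"
    using assms by (auto simp: abk abk' idx_def)
  define u where "u = Var 0 ^ (1 - a) * Var 0 ^ a' * (Var 1 ^ (1 - b) * Var 1 ^ b')"
  define w where "w = y_conj s (max 1 k) *
    ((if k = 0 then Var (1 + 2) else 1) * (if k' = 0 then 1 else Var (k' + 2)))"
  have prod: "dual_form s j * basis_form j' = w * u"
    by (simp add: abk abk' w_def u_def mult_ac)
  consider "a = 0 \<and> a' = 1" | "b = 0 \<and> b' = 1" | "a = a' \<and> b = b'"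
    | "a' \<le> a" "b' \<le> b" "a' + b' < a + b"
    using le by linarith
  then show ?thesis
  proof cases
    case 1
    then have "w * u = Var 0 * (Var 0 * (w * (Var 1 ^ (1 - b) * Var 1 ^ b')))"
      by (simp add: u_def mult_ac)
    then have "F_pairing n (w * u) = 0"
      by (simp only: F_pairing_xx)
    moreover have "j \<noteq> j'"
      using 1 by (auto simp: abk abk')
    ultimately show ?thesis
      by (simp add: prod)
  next
    case 2
    then have "w * u = Var 1 * (Var 1 * (w * (Var 0 ^ (1 - a) * Var 0 ^ a')))"
      by (simp add: u_def mult_ac)
    then have "F_pairing n (w * u) = 0"
      by (simp only: F_pairing_xx)
    moreover have "j \<noteq> j'"
      using 2 by (auto simp: abk abk')
    ultimately show ?thesis
      by (simp add: prod)
  next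
    case 3
    then have u: "u = Poly_Mapping.single (Poly_Mapping.single 0 1 + Poly_Mapping.single 1 1) 1"
      using le by (simp add: u_def power_add[symmetric]) (simp add: Var_def mult_single)
    have k0: "k = 0 \<longleftrightarrow> k' = 0"
      using deg 3 by (auto simp: abk abk' split: if_splits)
    have "w * u = y_conj s (max 1 k) * (Var (max 1 k' + 2) * u)"
      using k0 by (auto simp: w_def mult_ac max_def)
    then have "F_pairing n (w * u) = (if max 1 k = max 1 k' then 1 else 0)"
      using le by (simp only: F_pairing_y_conj_y) (simp add: u)
    moreover have "max 1 k = max 1 k' \<longleftrightarrow> j = j'"
      using k0 3 by (auto simp: abk abk' max_def)
    ultimately show ?thesis
      by (simp add: prod)
  next
    case 4
    then have "k = 0" "k' \<noteq> 0"
      using deg by (auto simp: abk abk' split: if_splits)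
    then have "w * u = y_conj s 1 * (Var (1 + 2) * (Var (k' + 2) * u))"
      by (simp add: w_def mult_ac)
    moreover have "F_pairing n (y_conj s 1 * (Var (1 + 2) * (Var (k' + 2) * u))) = 0"
      using n F_pairing_y_conj_y[of 1 n 1 s "Var (k' + 2) * u"]
      by (simp add: lookup_Var_mult lookup_add lookup_single)
    ultimately have "F_pairing n (w * u) = 0"
      by (simp only:)
    moreover have "j \<noteq> j'"
      using 4 by (auto simp: abk abk')
    ultimately show ?thesis
      by (simp add: prod)
  qed
qed

section \<open>Lifted monomials as functions on the points\<close>

text \<open>
  A linear form in the \<open>Y\<^sub>k\<close> can avoid only the points outside the line on which all
  \<open>y\<close>-coordinates vanish. That an apolar set of \<open>4 n\<close> points does not meet this line is a
  consequence of the count of independent forms on the points outside.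
\<close>

definition y_points :: "nat \<Rightarrow> (nat \<Rightarrow> complex) set set \<Rightarrow> (nat \<Rightarrow> complex) set set" where
  "y_points n X = {P\<in>X. \<exists>k<n. coords P (k + 2) \<noteq> 0}"

text \<open>
  At the remaining points of \<open>X\<close> the dual form vanishes, so the product lies in the vanishing ideal
  of all of \<open>X\<close>.
\<close>

lemma F_pairing_dual_form_vanishing:
  assumes n: "n \<ge> 2" and apolar: "apolar_set (n + 2) (F_quadric n) X" and j: "j \<in> idx n"
    and p: "p \<in> forms (n + 2) i" and van: "\<And>P. P \<in> y_points n X \<Longrightarrow> eval_at (coords P) p = 0"
  shows "F_pairing n (dual_form s j * p) = 0"
proof (rule F_pairing_vanishing_ideal[OF apolar])
  obtain d where d: "dual_form s j \<in> forms (n + 2) d"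
    using forms_dual_form[OF n j] by blast
  have X: "X \<subseteq> proj_space (n + 2)"
    using apolar by (simp add: apolar_set_def)
  have "eval_at (coords P) (dual_form s j * p) = 0" if "P \<in> X" for P
  proof (cases "P \<in> y_points n X")
    case False
    then have zero: "coords P (k + 2) = 0" if "k < n" for k
      using that \<open>P \<in> X\<close> by (auto simp: y_points_def)
    obtain a b k where abk: "j = (a, b, k)" by (cases j)
    then have "max 1 k < n"
      using n j by (auto simp: idx_def)
    then have "eval_at (coords P) (y_conj s (max 1 k)) = 0"
      unfolding y_conj_def using zero[of "max 1 k"] zero[of 0] n by simp
    then show ?thesis
      by (simp only: abk dual_form.simps eval_at_mult mult_zero_left)
  qed (simp add: van)
  then show "dual_form s j * p \<in> vanishing_ideal (n + 2) X"
    using form_in_vanishing_ideal_iff[OF X forms_mult[OF d p]] by blast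
qed

definition level :: "nat \<Rightarrow> nat \<Rightarrow> (nat \<times> nat \<times> nat) set" where
  "level n i = {j \<in> idx n. idx_deg j \<le> i}"

definition top_level :: "nat \<Rightarrow> nat \<Rightarrow> (nat \<times> nat \<times> nat) set" where
  "top_level n i = {j \<in> idx n. idx_deg j = i}"

text \<open>
  Powers of \<^const>\<open>y_form\<close> bring the monomials of degree at most \<open>i\<close> into degree \<open>i\<close>. On \<open>level n i\<close>,
  where this is used, the subtraction does not truncate.
\<close>

definition lifted_form :: "nat \<Rightarrow> complex \<Rightarrow> nat \<Rightarrow> nat \<times> nat \<times> nat \<Rightarrow> cpoly" where
  "lifted_form n s i j = y_form n s ^ (i - idx_deg j) * basis_form j"

lemma finite_idx: "finite (idx n)"
  by (simp add: idx_def)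

lemma finite_level: "finite (level n i)"
  using finite_idx[of n] by (simp add: level_def)

lemma level_Suc: "level n (Suc i) = level n i \<union> top_level n (Suc i)"
  by (auto simp: level_def top_level_def)

lemma level_0: "level n 0 = top_level n 0"
  by (auto simp: level_def top_level_def)

lemma lifted_form_in_forms: "lifted_form n s i ` level n i \<subseteq> forms (n + 2) i"
proof
  fix p assume "p \<in> lifted_form n s i ` level n i"
  then obtain j where j: "j \<in> idx n" "idx_deg j \<le> i" "p = lifted_form n s i j"
    by (auto simp: level_def)
  then have "p \<in> forms (n + 2) ((i - idx_deg j) * 1 + idx_deg j)"
    unfolding j(3) lifted_form_def
    by (intro forms_mult forms_power forms_y_form forms_basis_form)
  then show "p \<in> forms (n + 2) i"
    using j(2) by simp
qed

lemma lifted_combination_Suc: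
  "(\<Sum>j\<in>level n (Suc i). const (c j) * lifted_form n s (Suc i) j) =
     y_form n s * (\<Sum>j\<in>level n i. const (c j) * lifted_form n s i j) +
     (\<Sum>j\<in>top_level n (Suc i). const (c j) * basis_form j)"
proof -
  have fin: "finite (level n i)" "finite (top_level n (Suc i))"
    using finite_idx[of n] by (simp_all add: level_def top_level_def)
  have "(\<Sum>j\<in>level n i. const (c j) * lifted_form n s (Suc i) j) =
      y_form n s * (\<Sum>j\<in>level n i. const (c j) * lifted_form n s i j)"
    unfolding sum_distrib_left
    by (intro sum.cong refl) (auto simp: level_def lifted_form_def Suc_diff_le mult_ac)
  moreover have "(\<Sum>j\<in>top_level n (Suc i). const (c j) * lifted_form n s (Suc i) j) =
      (\<Sum>j\<in>top_level n (Suc i). const (c j) * basis_form j)"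
    by (intro sum.cong refl) (auto simp: top_level_def lifted_form_def)
  ultimately show ?thesis
    unfolding level_Suc using fin
    by (subst sum.union_disjoint) (auto simp: level_def top_level_def)
qed

text \<open>
  Pairing with the dual form of a monomial of degree \<open>i\<close> isolates its coefficient, because the
  multiple of \<^const>\<open>y_form\<close> contributes nothing. The cofactor \<open>q\<close> is left arbitrary: it is a
  combination of lifted monomials in the proof of independence, and involves an unknown form in the
  proof that they span.
\<close>

lemma top_coefficients_vanish:
  assumes n: "n \<ge> 2" and apolar: "apolar_set (n + 2) (F_quadric n) X"
    and p: "p = y_form n s * q + (\<Sum>j\<in>top_level n i. const (c j) * basis_form j)"
    and form: "p \<in> forms (n + 2) i"
    and van: "\<And>P. P \<in> y_points n X \<Longrightarrow> eval_at (coords P) p = 0"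
    and j: "j \<in> top_level n i"
  shows "c j = 0"
proof -
  have jn: "j \<in> idx n"
    using j by (simp add: top_level_def)
  have "dual_form s j * p = dual_form s j * (y_form n s * q) +
      (\<Sum>l\<in>top_level n i. const (c l) * (dual_form s j * basis_form l))"
    unfolding p by (simp add: distrib_left sum_distrib_left mult_ac)
  then have "F_pairing n (dual_form s j * p) =
      (\<Sum>l\<in>top_level n i. c l * F_pairing n (dual_form s j * basis_form l))"
    by (simp add: F_pairing_sum F_pairing_dual_form_y_form[OF n jn])
  also have "\<dots> = (\<Sum>l\<in>top_level n i. if l = j then c j else 0)"
    using j by (intro sum.cong refl) (auto simp: F_pairing_dual_form_basis_form[OF n jn] top_level_def)
  also have "\<dots> = c j"
    using j finite_idx[of n] by (simp add: top_level_def)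
  finally show ?thesis
    using F_pairing_dual_form_vanishing[OF n apolar jn form van] by simp
qed

text \<open>
  In a relation the coefficients in the top degree vanish; what is left is a multiple of
  \<^const>\<open>y_form\<close>, which can be divided out since it has no zero among the points, and the degree
  drops by one.
\<close>

lemma lifted_forms_independent:
  assumes n: "n \<ge> 2" and apolar: "apolar_set (n + 2) (F_quadric n) X"
    and s: "\<And>P. P \<in> y_points n X \<Longrightarrow> eval_at (coords P) (y_form n s) \<noteq> 0"
  shows "indep_mod (vanishing_ideal (n + 2) (y_points n X) \<inter> forms (n + 2) i)
    (lifted_form n s i) (level n i)"
proof -
  have Y: "y_points n X \<subseteq> proj_space (n + 2)"
    using apolar by (auto simp: apolar_set_def y_points_def)
  have "\<forall>j\<in>level n i. c j = 0"
    if "\<And>P. P \<in> y_points n X \<Longrightarrow>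
      eval_at (coords P) (\<Sum>j\<in>level n i. const (c j) * lifted_form n s i j) = 0" for c
    using that
  proof (induction i)
    case 0
    let ?p = "\<Sum>j\<in>level n 0. const (c j) * lifted_form n s 0 j"
    have "?p = y_form n s * 0 + (\<Sum>j\<in>top_level n 0. const (c j) * basis_form j)"
      unfolding level_0 by (auto simp: lifted_form_def intro!: sum.cong)
    moreover have "?p \<in> forms (n + 2) 0"
      using lifted_form_in_forms[of n s 0] by (intro forms_sum forms_const_mult) auto
    ultimately show ?case
      using top_coefficients_vanish[OF n apolar _ _ 0] unfolding level_0 by blast
  next
    case (Suc i)
    let ?p = "\<Sum>j\<in>level n (Suc i). const (c j) * lifted_form n s (Suc i) j"
    let ?q = "\<Sum>j\<in>level n i. const (c j) * lifted_form n s i j"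
    have "?p \<in> forms (n + 2) (Suc i)"
      using lifted_form_in_forms[of n s "Suc i"] by (intro forms_sum forms_const_mult) auto
    then have top: "\<forall>j\<in>top_level n (Suc i). c j = 0"
      using top_coefficients_vanish[OF n apolar lifted_combination_Suc _ Suc.prems] by blast
    then have "?p = y_form n s * ?q"
      by (simp add: lifted_combination_Suc)
    then have "eval_at (coords P) ?q = 0" if "P \<in> y_points n X" for P
      using Suc.prems[OF that] s[OF that] by simp
    then show ?case
      using Suc.IH top by (auto simp: level_Suc)
  qed
  then show ?thesis
    unfolding indep_mod_def forms_in_vanishing_ideal_eq[OF Y] by blast
qed

text \<open>
  Expand \<open>y_form \<cdot> g\<close> one degree higher. The monomials of top degree do not occur in the expansion,
  by the pairing, so it can be divided by \<^const>\<open>y_form\<close>.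
\<close>

lemma lifted_forms_span_down:
  assumes n: "n \<ge> 2" and apolar: "apolar_set (n + 2) (F_quadric n) X" and Y: "y_points n X = X"
    and s: "\<And>P. P \<in> X \<Longrightarrow> eval_at (coords P) (y_form n s) \<noteq> 0"
    and span: "spans_mod (vanishing_ideal (n + 2) X \<inter> forms (n + 2) (Suc i)) (forms (n + 2) (Suc i))
      (lifted_form n s (Suc i)) (level n (Suc i))"
  shows "spans_mod (vanishing_ideal (n + 2) X \<inter> forms (n + 2) i) (forms (n + 2) i)
      (lifted_form n s i) (level n i)"
  unfolding spans_mod_def
proof
  fix g assume g: "g \<in> forms (n + 2) i"
  have X: "X \<subseteq> proj_space (n + 2)"
    using apolar by (simp add: apolar_set_def)
  have "y_form n s * g \<in> forms (n + 2) (Suc i)"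
    using forms_mult[OF forms_y_form g] by simp
  then obtain c where c:
    "y_form n s * g - (\<Sum>j\<in>level n (Suc i). const (c j) * lifted_form n s (Suc i) j)
      \<in> vanishing_ideal (n + 2) X \<inter> forms (n + 2) (Suc i)" (is "?p \<in> _")
    using span unfolding spans_mod_def by blast
  let ?q = "g - (\<Sum>j\<in>level n i. const (c j) * lifted_form n s i j)"
  have p: "?p = y_form n s * ?q + (\<Sum>j\<in>top_level n (Suc i). const (- c j) * basis_form j)"
    by (simp add: lifted_combination_Suc right_diff_distrib const_uminus sum_negf)
  have van: "eval_at (coords P) ?p = 0" if "P \<in> X" for P
    using c that unfolding forms_in_vanishing_ideal_eq[OF X] by blast
  have "- c j = 0" if "j \<in> top_level n (Suc i)" for j
    using c van by (intro top_coefficients_vanish[OF n apolar p _ _ that]) (auto simp: Y)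
  then have "(\<Sum>j\<in>top_level n (Suc i). const (- c j) * basis_form j) = 0"
    by (simp only: const_simps mult_zero_left sum.neutral_const cong: sum.cong)
  then have pq: "?p = y_form n s * ?q"
    using p by (simp only: add_0_right)
  have "eval_at (coords P) ?q = 0" if "P \<in> X" for P
  proof -
    have "eval_at (coords P) (y_form n s) * eval_at (coords P) ?q = 0"
      using van[OF that] by (simp only: pq eval_at_mult)
    then show ?thesis
      using s[OF that] by (simp only: mult_eq_0_iff simp_thms)
  qed
  moreover have "?q \<in> forms (n + 2) i"
    using g lifted_form_in_forms[of n s i] by (intro forms_diff forms_sum forms_const_mult) auto
  ultimately show "\<exists>c. g - (\<Sum>j\<in>level n i. const (c j) * lifted_form n s i j)
      \<in> vanishing_ideal (n + 2) X \<inter> forms (n + 2) i"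
    unfolding forms_in_vanishing_ideal_eq[OF X] by (intro exI[of _ c]) simp
qed

lemma y_form_avoiding_points:
  assumes "finite X"
  shows "\<exists>s. \<forall>P\<in>y_points n X. eval_at (coords P) (y_form n s) \<noteq> 0"
proof -
  define f where "f P = (\<Sum>k<n. monom (coords P (k + 2)) k)" for P
  have f: "poly (f P) s = eval_at (coords P) (y_form n s)" for P s
    by (simp add: f_def poly_sum poly_monom eval_at_y_form mult.commute)
  have "finite {s. poly (f P) s = 0}" if P: "P \<in> y_points n X" for P
  proof (rule poly_roots_finite)
    obtain k where k: "k < n" "coords P (k + 2) \<noteq> 0"
      using P by (auto simp: y_points_def)
    then have "coeff (f P) k \<noteq> 0"
      by (simp add: f_def coeff_sum)
    then show "f P \<noteq> 0"
      by auto
  qed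
  then have "finite (\<Union>P\<in>y_points n X. {s. poly (f P) s = 0})"
    using assms by (auto simp: y_points_def)
  then obtain s where "s \<notin> (\<Union>P\<in>y_points n X. {s. poly (f P) s = 0})"
    using ex_new_if_finite[OF infinite_UNIV_char_0] by blast
  then show ?thesis
    by (auto simp: f)
qed

section \<open>The Hilbert function\<close>

lemma level_eq_Sigma:
  "level n i = (SIGMA a:{..1}. SIGMA b:{..1}. {k. k < n \<and> idx_deg (a, b, k) \<le> i})"
  by (auto simp: level_def idx_def)

lemma card_level:
  assumes "n \<ge> 2"
  shows "card (level n 0) = 1" "card (level n 1) = n + 2" "card (level n 2) = 3 * n + 1"
    "i \<ge> 3 \<Longrightarrow> card (level n i) = 4 * n"
proof -
  have at: "{..1} = {0, 1 :: nat}"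
    by auto
  \<comment> \<open>One monomial has \<open>Y\<close>-degree \<open>0\<close>, namely \<open>k = 0\<close>; the other \<open>n - 1\<close> have \<open>Y\<close>-degree \<open>1\<close>.\<close>
  have k: "{k. k < n \<and> idx_deg (a, b, k) \<le> i} =
      (if a + b < i then {..<n} else if a + b = i then {0} else {})" for a b i
    using assms by auto
  have card: "card (level n i) = (\<Sum>a\<le>1. \<Sum>b\<le>1.
      card (if a + b < i then {..<n} else if a + b = i then {0} else {} :: nat set))" for i
    unfolding level_eq_Sigma k by (subst card_SigmaI) auto
  show "card (level n 0) = 1" "card (level n 1) = n + 2" "card (level n 2) = 3 * n + 1"
    "i \<ge> 3 \<Longrightarrow> card (level n i) = 4 * n"
    unfolding card at by auto
qed

theorem proposition5p5:
  fixes n :: nat and X :: "(nat \<Rightarrow> complex) set set"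
  assumes "n \<ge> 2"
    and "minimal_apolar_set (n + 2) (F_quadric n) X"
  shows "hilbert_fun (n + 2) X 0 = 1 \<and>
         hilbert_fun (n + 2) X 1 = n + 2 \<and>
         hilbert_fun (n + 2) X 2 = 3 * n + 1 \<and>
         (\<forall>i\<ge>3. hilbert_fun (n + 2) X i = 4 * n)"
proof -
  let ?I = "\<lambda>i. vanishing_ideal (n + 2) X \<inter> forms (n + 2) i"
  have apolar: "apolar_set (n + 2) (F_quadric n) X"
    and card_X: "card X \<le> 4 * n"
    using assms waring_rank_F_quadric_le[OF assms(1)] by (auto simp: minimal_apolar_set_def)
  then have fin: "finite X" and X: "X \<subseteq> proj_space (n + 2)"
    by (auto simp: apolar_set_def)
  obtain s where s: "\<And>P. P \<in> y_points n X \<Longrightarrow> eval_at (coords P) (y_form n s) \<noteq> 0"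
    using y_form_avoiding_points[OF fin] by blast
  note indep = lifted_forms_independent[OF assms(1) apolar s]
  \<comment> \<open>In degree \<open>3\<close> all \<open>4 n\<close> monomials are available, so the points off the line already number \<open>4 n\<close>.\<close>
  have "y_points n X = X"
  proof (rule card_subset_eq[OF fin])
    show sub: "y_points n X \<subseteq> X"
      by (auto simp: y_points_def)
    have "card (level n 3) \<le> card (y_points n X)"
      using finite_subset[OF sub fin] sub X finite_level lifted_form_in_forms indep
      by (intro card_indep_forms_le_card_points[of _ "n + 2" _ "lifted_form n s 3" 3]) auto
    then show "card (y_points n X) = card X"
      using card_X card_mono[OF fin sub] card_level(4)[OF assms(1), of 3] by simp
  qed
  note Y = this and s = s[unfolded this] and indep = indep[unfolded this]
  have span_ge: "spans_mod (?I i) (forms (n + 2) i) (lifted_form n s i) (level n i)" if "i \<ge> 3" for i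
    using card_X card_level(4)[OF assms(1) that]
    by (intro indep_forms_span fin X finite_level lifted_form_in_forms indep) simp_all
  have "spans_mod (?I i) (forms (n + 2) i) (lifted_form n s i) (level n i)" for i
  proof (cases "i \<le> 3")
    case True
    then show ?thesis
    proof (induction i rule: inc_induct)
      case base
      show ?case by (rule span_ge) simp
    next
      case (step i)
      show ?case
        by (rule lifted_forms_span_down[OF assms(1) apolar Y s step.IH])
    qed
  next
    case False
    then show ?thesis
      by (intro span_ge) simp
  qed
  then have "hilbert_fun (n + 2) X i = card (level n i)" for i
    unfolding hilbert_fun_def
    by (rule quot_dim_eq_card[OF lin_subspace_forms lin_subspace_vanishing_forms[OF X] finite_level
        lifted_form_in_forms _ indep])
  then show ?thesis
    using card_level[OF assms(1)] by simp
qed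

end
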